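(* Let $H=(V,F)$ be a finite hypergraph, $\Psi_\alpha:\{\pm1\}^\alpha\to(0,\infty)$ ($\alpha\in F$), $Z=\sum_{x\in\{\pm1\}^V}\prod_\alpha\Psi_\alpha(x_\alpha)$ and $p(x)=Z^{-1}\prod_\alpha\Psi_\alpha(x_\alpha)$ with marginal $p_1$ at a fixed vertex $1\in V$. Let $\{b_\alpha,b_i\}$ be an LBP fixed point (beliefs) with Bethe approximation $Z_B$, as in the context. Then $$\frac{Z}{Z_B}\cdot\frac{p_1(+1)-p_1(-1)}{\sqrt{b_1(+1)b_1(-1)}}=\sum_{s\subset E_{B_H}}(-1)^{|s|}\prod_{\alpha\in F}\beta^\alpha_{I_\alpha(s)}\prod_{i\in V\setminus\{1\}}f_{d_i(s)}(\gamma_i)\ g_{d_1(s)}(\gamma_1).$$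
   Context: $d_i=|\{\alpha:i\in\alpha\}|$. Beliefs (LBP fixed points): strictly positive probability functions $b_\alpha$ on $\{\pm1\}^\alpha$ and $b_i$ on $\{\pm1\}$ such that $b_i$ is the $x_i$-marginal of $b_\alpha$ for $i\in\alpha$ and $\prod_\alpha b_\alpha(x_\alpha)\prod_ib_i(x_i)^{1-d_i}\propto\prod_\alpha\Psi_\alpha(x_\alpha)$. $Z_B=\exp(-F(b))$ with $F(b)=-\sum_\alpha\sum_{x_\alpha}b_\alpha\log\Psi_\alpha+\sum_\alpha\sum_{x_\alpha}b_\alpha\log b_\alpha+\sum_i(1-d_i)\sum_{x_i}b_i\log b_i$. $B_H$ is the bipartite graph on $V\cup F$ with edge set $E_{B_H}=\{\{i,\alpha\}:i\in\alpha\}$; for $s\subset E_{B_H}$, $I_\alpha(s)=\{i:\{i,\alpha\}\in s\}$ and $d_i(s)=|\{\alpha:\{i,\alpha\}\in s\}|$. With $m_i=\mathbb{E}_{b_i}[x_i]$: $\beta^\alpha_I=\mathbb{E}_{b_\alpha}\big[\prod_{i\in I}\frac{x_i-m_i}{\sqrt{1-m_i^2}}\big]$ for $I\subset\alpha$ (so $\beta^\alpha_\emptyset=1$), and $\gamma_i=\frac{2m_i}{\sqrt{1-m_i^2}}$. Polynomials: $f_0=1,f_1=0,f_{n+1}(x)=xf_n(x)+f_{n-1}(x)$; $g_0(x)=x,g_1=-2,g_{n+1}(x)=xg_n(x)+g_{n-1}(x)$.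
   Formalization: LBP fixed point also requires that the beliefs come from positive messages (b_i ∝ product of messages, b_α ∝ Ψ_α times incoming messages); with only marginal consistency and the product identity the claim fails when two hyperedges share two or more vertices. *)

theory Defs
  imports Complex_Main "HOL-Library.FuncSet" "HOL-Computational_Algebra.Polynomial"
begin

definition hypergraph :: "'v set \<Rightarrow> 'v set set \<Rightarrow> bool" where
  "hypergraph V F \<longleftrightarrow> finite V \<and> F \<subseteq> Pow V"

text \<open>
  \<open>configs A\<close> is \<open>{+1,-1}\<^sup>A\<close>. Configurations are extensional functions, so the coordinate
  projection \<open>x\<^sub>\<alpha>\<close> of \<open>x\<close> is \<open>restrict x \<alpha>\<close>, and functions on \<open>{+1,-1}\<^sup>A\<close>
  are only ever used on \<open>configs A\<close>.
\<close>

definition configs :: "'v set \<Rightarrow> ('v \<Rightarrow> real) set" where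
  "configs A = A \<rightarrow>\<^sub>E {-1, 1}"

definition weight :: "'v set set \<Rightarrow> ('v set \<Rightarrow> ('v \<Rightarrow> real) \<Rightarrow> real) \<Rightarrow> ('v \<Rightarrow> real) \<Rightarrow> real" where
  "weight F \<Psi> x = (\<Prod>\<alpha>\<in>F. \<Psi> \<alpha> (restrict x \<alpha>))"

definition partition_function ::
    "'v set \<Rightarrow> 'v set set \<Rightarrow> ('v set \<Rightarrow> ('v \<Rightarrow> real) \<Rightarrow> real) \<Rightarrow> real" where
  "partition_function V F \<Psi> = (\<Sum>x\<in>configs V. weight F \<Psi> x)"

definition gibbs ::
    "'v set \<Rightarrow> 'v set set \<Rightarrow> ('v set \<Rightarrow> ('v \<Rightarrow> real) \<Rightarrow> real) \<Rightarrow> ('v \<Rightarrow> real) \<Rightarrow> real" where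
  "gibbs V F \<Psi> x = weight F \<Psi> x / partition_function V F \<Psi>"

definition marginal :: "'v set \<Rightarrow> (('v \<Rightarrow> real) \<Rightarrow> real) \<Rightarrow> 'v \<Rightarrow> real \<Rightarrow> real" where
  "marginal A q i t = (\<Sum>x\<in>{x \<in> configs A. x i = t}. q x)"

definition positive_probability_on :: "'a set \<Rightarrow> ('a \<Rightarrow> real) \<Rightarrow> bool" where
  "positive_probability_on S q \<longleftrightarrow> (\<forall>x\<in>S. q x > 0) \<and> sum q S = 1"

definition proportional_on :: "'a set \<Rightarrow> ('a \<Rightarrow> real) \<Rightarrow> ('a \<Rightarrow> real) \<Rightarrow> bool" where
  "proportional_on S p q \<longleftrightarrow> (\<exists>c>0. \<forall>x\<in>S. p x = c * q x)"

definition vertex_degree :: "'v set set \<Rightarrow> 'v \<Rightarrow> nat" where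
  "vertex_degree F i = card {\<alpha> \<in> F. i \<in> \<alpha>}"

definition locally_consistent ::
    "'v set \<Rightarrow> 'v set set \<Rightarrow> ('v set \<Rightarrow> ('v \<Rightarrow> real) \<Rightarrow> real) \<Rightarrow> ('v \<Rightarrow> real \<Rightarrow> real) \<Rightarrow> bool" where
  "locally_consistent V F b bv \<longleftrightarrow>
     (\<forall>\<alpha>\<in>F. positive_probability_on (configs \<alpha>) (b \<alpha>)) \<and>
     (\<forall>i\<in>V. positive_probability_on {-1, 1} (bv i)) \<and>
     (\<forall>\<alpha>\<in>F. \<forall>i\<in>\<alpha>. \<forall>t\<in>{-1, 1}. bv i t = marginal \<alpha> (b \<alpha>) i t)"

definition reparametrises ::
    "'v set \<Rightarrow> 'v set set \<Rightarrow> ('v set \<Rightarrow> ('v \<Rightarrow> real) \<Rightarrow> real)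
      \<Rightarrow> ('v set \<Rightarrow> ('v \<Rightarrow> real) \<Rightarrow> real) \<Rightarrow> ('v \<Rightarrow> real \<Rightarrow> real) \<Rightarrow> bool" where
  "reparametrises V F \<Psi> b bv \<longleftrightarrow>
     proportional_on (configs V)
       (\<lambda>x. weight F b x * (\<Prod>i\<in>V. bv i (x i) powi (1 - int (vertex_degree F i))))
       (weight F \<Psi>)"

text \<open>
  \<open>\<mu> \<alpha> i t\<close> is the value at \<open>x\<^sub>i = t\<close> of the loopy belief propagation message from the
  hyperedge \<open>\<alpha>\<close> to the vertex \<open>i\<close>. The two clauses are the standard formulas for the beliefs
  in terms of the messages. Together with local consistency they imply that \<open>\<mu>\<close> is, up to
  normalisation, a fixed point of the message update: marginalising the formula for
  \<open>b \<alpha>\<close> over the vertices other than \<open>i\<close> and comparing with the formula for \<open>bv i\<close>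
  shows that \<open>\<mu> \<alpha> i t\<close> is proportional to the sum, over \<open>x \<in> configs \<alpha>\<close> with
  \<open>x i = t\<close>, of \<open>\<Psi> \<alpha> x\<close> times the product of all \<open>\<mu> \<alpha>' j (x j)\<close> with
  \<open>j \<in> \<alpha> - {i}\<close>, \<open>j \<in> \<alpha>'\<close> and \<open>\<alpha>' \<noteq> \<alpha>\<close>.
\<close>

definition beliefs_of_messages ::
    "'v set \<Rightarrow> 'v set set \<Rightarrow> ('v set \<Rightarrow> ('v \<Rightarrow> real) \<Rightarrow> real) \<Rightarrow> ('v set \<Rightarrow> 'v \<Rightarrow> real \<Rightarrow> real)
      \<Rightarrow> ('v set \<Rightarrow> ('v \<Rightarrow> real) \<Rightarrow> real) \<Rightarrow> ('v \<Rightarrow> real \<Rightarrow> real) \<Rightarrow> bool" where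
  "beliefs_of_messages V F \<Psi> \<mu> b bv \<longleftrightarrow>
     (\<forall>\<alpha>\<in>F. \<forall>i\<in>\<alpha>. \<forall>t\<in>{-1, 1}. \<mu> \<alpha> i t > 0) \<and>
     (\<forall>i\<in>V. proportional_on {-1, 1} (bv i) (\<lambda>t. \<Prod>\<alpha>\<in>{\<alpha> \<in> F. i \<in> \<alpha>}. \<mu> \<alpha> i t)) \<and>
     (\<forall>\<alpha>\<in>F. proportional_on (configs \<alpha>) (b \<alpha>)
        (\<lambda>x. \<Psi> \<alpha> x * (\<Prod>j\<in>\<alpha>. \<Prod>\<alpha>'\<in>{\<alpha>' \<in> F. j \<in> \<alpha>' \<and> \<alpha>' \<noteq> \<alpha>}. \<mu> \<alpha>' j (x j))))"

text \<open>
  The existence of messages is not redundant. Local consistency and the reparametrisation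
  identity see \<open>\<Psi>\<close> only through the product of all the \<open>\<Psi> \<alpha>\<close>, whereas the Bethe free
  energy depends on the individual factors: if two hyperedges share two vertices, one can move a
  function of these two vertices from one factor to the other, which changes the free
  energy at the given beliefs but not the product. (When any two distinct hyperedges
  share at most one vertex, the messages exist automatically.)
\<close>

definition lbp_fixed_point ::
    "'v set \<Rightarrow> 'v set set \<Rightarrow> ('v set \<Rightarrow> ('v \<Rightarrow> real) \<Rightarrow> real)
      \<Rightarrow> ('v set \<Rightarrow> ('v \<Rightarrow> real) \<Rightarrow> real) \<Rightarrow> ('v \<Rightarrow> real \<Rightarrow> real) \<Rightarrow> bool" where
  "lbp_fixed_point V F \<Psi> b bv \<longleftrightarrow>
     locally_consistent V F b bv \<and>
     reparametrises V F \<Psi> b bv \<and>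
     (\<exists>\<mu>. beliefs_of_messages V F \<Psi> \<mu> b bv)"

definition bethe_free_energy ::
    "'v set \<Rightarrow> 'v set set \<Rightarrow> ('v set \<Rightarrow> ('v \<Rightarrow> real) \<Rightarrow> real)
      \<Rightarrow> ('v set \<Rightarrow> ('v \<Rightarrow> real) \<Rightarrow> real) \<Rightarrow> ('v \<Rightarrow> real \<Rightarrow> real) \<Rightarrow> real" where
  "bethe_free_energy V F \<Psi> b bv =
     - (\<Sum>\<alpha>\<in>F. \<Sum>x\<in>configs \<alpha>. b \<alpha> x * ln (\<Psi> \<alpha> x))
     + (\<Sum>\<alpha>\<in>F. \<Sum>x\<in>configs \<alpha>. b \<alpha> x * ln (b \<alpha> x))
     + (\<Sum>i\<in>V. (1 - real (vertex_degree F i)) * (\<Sum>t\<in>{-1, 1}. bv i t * ln (bv i t)))"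

definition bethe_partition_function ::
    "'v set \<Rightarrow> 'v set set \<Rightarrow> ('v set \<Rightarrow> ('v \<Rightarrow> real) \<Rightarrow> real)
      \<Rightarrow> ('v set \<Rightarrow> ('v \<Rightarrow> real) \<Rightarrow> real) \<Rightarrow> ('v \<Rightarrow> real \<Rightarrow> real) \<Rightarrow> real" where
  "bethe_partition_function V F \<Psi> b bv = exp (- bethe_free_energy V F \<Psi> b bv)"

definition belief_mean :: "('v \<Rightarrow> real \<Rightarrow> real) \<Rightarrow> 'v \<Rightarrow> real" where
  "belief_mean bv i = (\<Sum>t\<in>{-1, 1}. bv i t * t)"

definition loop_beta ::
    "('v set \<Rightarrow> ('v \<Rightarrow> real) \<Rightarrow> real) \<Rightarrow> ('v \<Rightarrow> real \<Rightarrow> real) \<Rightarrow> 'v set \<Rightarrow> 'v set \<Rightarrow> real" where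
  "loop_beta b bv \<alpha> I =
     (\<Sum>x\<in>configs \<alpha>. b \<alpha> x *
        (\<Prod>i\<in>I. (x i - belief_mean bv i) / sqrt (1 - (belief_mean bv i)\<^sup>2)))"

definition loop_gamma :: "('v \<Rightarrow> real \<Rightarrow> real) \<Rightarrow> 'v \<Rightarrow> real" where
  "loop_gamma bv i = 2 * belief_mean bv i / sqrt (1 - (belief_mean bv i)\<^sup>2)"

text \<open>
  The edge \<open>{i, \<alpha>}\<close> of the bipartite incidence graph on the disjoint union of \<open>V\<close> and \<open>F\<close>
  is encoded as the pair \<open>(i, \<alpha>)\<close>.
\<close>

definition incidence_edges :: "'v set set \<Rightarrow> ('v \<times> 'v set) set" where
  "incidence_edges F = {(i, \<alpha>). \<alpha> \<in> F \<and> i \<in> \<alpha>}"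

definition edge_vertices :: "('v \<times> 'v set) set \<Rightarrow> 'v set \<Rightarrow> 'v set" where
  "edge_vertices s \<alpha> = {i. (i, \<alpha>) \<in> s}"

definition sub_degree :: "('v \<times> 'v set) set \<Rightarrow> 'v \<Rightarrow> nat" where
  "sub_degree s i = card {\<alpha>. (i, \<alpha>) \<in> s}"

fun loop_f :: "nat \<Rightarrow> real poly" where
  "loop_f 0 = 1"
| "loop_f (Suc 0) = 0"
| "loop_f (Suc (Suc n)) = [:0, 1:] * loop_f (Suc n) + loop_f n"

fun loop_g :: "nat \<Rightarrow> real poly" where
  "loop_g 0 = [:0, 1:]"
| "loop_g (Suc 0) = [:-2:]"
| "loop_g (Suc (Suc n)) = [:0, 1:] * loop_g (Suc n) + loop_g n"

end

theory Submission
  imports Defs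
begin

text \<open>
  With \<open>y\<^sub>i(t) = (t - m\<^sub>i) / sqrt (1 - m\<^sub>i\<^sup>2)\<close>, the functions \<open>1, y\<^sub>i\<close> form an orthonormal
  basis of \<open>L\<^sup>2(b\<^sub>i)\<close>, so \<open>b\<^sub>\<alpha>\<close> divided by the product of its vertex marginals
  expands as \<open>\<Sum>I. \<beta>\<^sup>\<alpha>\<^sub>I \<Prod>i\<in>I. y\<^sub>i\<close>. At a fixed point, \<open>exp (F(b))\<close> times the weight of
  \<open>x\<close> is \<open>\<Prod>i. b\<^sub>i(x\<^sub>i)\<close> times the product over all \<open>\<alpha>\<close> of these expansions. Multiplying out gives
  a sum over sets of incidences in which the sum over \<open>x\<close> factorises over vertices.
  The values of \<open>- y\<^sub>i\<close> are the two roots of \<open>z\<^sup>2 = \<gamma>\<^sub>i z + 1\<close>, so the moments of \<open>- y\<^sub>i\<close>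
  under \<open>b\<^sub>i\<close>, with or without the extra factor \<open>2 x\<^sub>i / sqrt (1 - m\<^sub>i\<^sup>2)\<close>,
  satisfy the recursion of \<open>f\<close> and \<open>g\<close>.
\<close>

definition standardised :: "('v \<Rightarrow> real \<Rightarrow> real) \<Rightarrow> 'v \<Rightarrow> real \<Rightarrow> real" where
  "standardised bv i t = (t - belief_mean bv i) / sqrt (1 - (belief_mean bv i)\<^sup>2)"

section \<open>Configurations, and regrouping of sums and products over incidences\<close>

lemma hypergraph_finite:
  assumes "hypergraph V F"
  shows "finite V" "finite F" "\<alpha> \<in> F \<Longrightarrow> \<alpha> \<subseteq> V" "\<alpha> \<in> F \<Longrightarrow> finite \<alpha>"
  using assms finite_subset[of F "Pow V"] finite_subset[of \<alpha> V]
  unfolding hypergraph_def by auto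

lemma finite_configs: "finite A \<Longrightarrow> finite (configs A)"
  unfolding configs_def by (rule finite_PiE) auto

lemma configs_value: "x \<in> configs A \<Longrightarrow> i \<in> A \<Longrightarrow> x i \<in> {-1, 1}"
  unfolding configs_def by (auto dest: PiE_mem)

lemma restrict_configs: "x \<in> configs V \<Longrightarrow> \<alpha> \<subseteq> V \<Longrightarrow> restrict x \<alpha> \<in> configs \<alpha>"
  unfolding configs_def by (auto simp: PiE_iff)

lemma sum_incidence_swap:
  assumes "hypergraph V F"
  shows "(\<Sum>\<alpha>\<in>F. \<Sum>j\<in>\<alpha>. (G \<alpha> j :: real)) = (\<Sum>j\<in>V. \<Sum>\<alpha>\<in>{\<alpha> \<in> F. j \<in> \<alpha>}. G \<alpha> j)"
proof -
  have "(\<Sum>\<alpha>\<in>F. \<Sum>j\<in>\<alpha>. G \<alpha> j) = (\<Sum>\<alpha>\<in>F. \<Sum>j\<in>{j \<in> V. j \<in> \<alpha>}. G \<alpha> j)"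
    using hypergraph_finite[OF assms] by (intro sum.cong refl) auto
  also have "\<dots> = (\<Sum>j\<in>V. \<Sum>\<alpha>\<in>{\<alpha> \<in> F. j \<in> \<alpha>}. G \<alpha> j)"
    by (rule sum.swap_restrict) (use hypergraph_finite[OF assms] in auto)
  finally show ?thesis .
qed

text \<open>Split \<open>s\<close> into the fibres \<open>{\<alpha>. (i, \<alpha>) \<in> s}\<close>,
  on each of which the factor is the constant \<open>h i\<close>. The choice
  \<open>h = (\<lambda>_. -1)\<close> later distributes the sign \<open>(-1) ^ card s\<close> over
  the vertices.\<close>

lemma prod_edges_by_vertex:
  fixes h :: "'v \<Rightarrow> real"
  assumes "hypergraph V F" "s \<subseteq> incidence_edges F"
  shows "(\<Prod>e\<in>s. h (fst e)) = (\<Prod>i\<in>V. h i ^ sub_degree s i)"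
proof -
  have s: "s = (SIGMA i:V. {\<alpha>. (i, \<alpha>) \<in> s})"
    using assms hypergraph_finite(3)[OF assms(1)] by (auto simp: incidence_edges_def)
  have fin: "finite {\<alpha>. (i, \<alpha>) \<in> s}" for i
    by (rule finite_subset[of _ F])
       (use assms hypergraph_finite(2)[OF assms(1)] in \<open>auto simp: incidence_edges_def\<close>)
  have "(\<Prod>i\<in>V. h i ^ sub_degree s i) = (\<Prod>i\<in>V. \<Prod>\<alpha>\<in>{\<alpha>. (i, \<alpha>) \<in> s}. h i)"
    by (simp add: sub_degree_def)
  also have "\<dots> = (\<Prod>e\<in>(SIGMA i:V. {\<alpha>. (i, \<alpha>) \<in> s}). h (fst e))"
    using hypergraph_finite(1)[OF assms(1)] fin by (subst prod.Sigma) (auto simp: case_prod_beta)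
  finally show ?thesis by (simp flip: s)
qed

lemma prod_edge_vertices_by_vertex:
  fixes h :: "'v \<Rightarrow> real"
  assumes "hypergraph V F" "s \<subseteq> incidence_edges F"
  shows "(\<Prod>\<alpha>\<in>F. \<Prod>i\<in>edge_vertices s \<alpha>. h i) = (\<Prod>i\<in>V. h i ^ sub_degree s i)"
proof -
  have fin: "finite (edge_vertices s \<alpha>)" for \<alpha>
    by (rule finite_subset[of _ V])
       (use assms hypergraph_finite(1,3)[OF assms(1)]
         in \<open>auto simp: incidence_edges_def edge_vertices_def\<close>)
  have "(\<Prod>\<alpha>\<in>F. \<Prod>i\<in>edge_vertices s \<alpha>. h i)
      = (\<Prod>e\<in>(SIGMA \<alpha>:F. edge_vertices s \<alpha>). h (snd e))"
    using hypergraph_finite(2)[OF assms(1)] fin by (subst prod.Sigma) (auto simp: case_prod_beta)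
  also have "\<dots> = (\<Prod>e\<in>s. h (fst e))"
  proof -
    have "\<alpha> \<in> F" if "(i, \<alpha>) \<in> s" for i \<alpha>
      using assms(2) that by (auto simp: incidence_edges_def)
    then show ?thesis
      by (intro prod.reindex_bij_witness[of _ prod.swap prod.swap])
         (auto simp: edge_vertices_def)
  qed
  finally show ?thesis using prod_edges_by_vertex[OF assms] by simp
qed

text \<open>The case where \<open>s\<close> consists of all incidences, so that
  \<open>edge_vertices s \<alpha>\<close> is \<alpha> itself.\<close>

lemma prod_incidence_by_vertex:
  fixes h :: "'v \<Rightarrow> real"
  assumes "hypergraph V F"
  shows "(\<Prod>\<alpha>\<in>F. \<Prod>i\<in>\<alpha>. h i) = (\<Prod>i\<in>V. h i ^ vertex_degree F i)"
proof -
  have "(\<Prod>\<alpha>\<in>F. \<Prod>i\<in>edge_vertices (incidence_edges F) \<alpha>. h i) = (\<Prod>\<alpha>\<in>F. \<Prod>i\<in>\<alpha>. h i)"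
    by (intro prod.cong refl) (auto simp: edge_vertices_def incidence_edges_def)
  moreover have "sub_degree (incidence_edges F) i = vertex_degree F i" for i
    by (simp add: sub_degree_def vertex_degree_def incidence_edges_def)
  ultimately show ?thesis
    using prod_edge_vertices_by_vertex[OF assms, of "incidence_edges F" h] by simp
qed

text \<open>Choosing one subset of every hyperedge is the same as choosing a set of incidences, a
  family of subsets being recorded as its graph. This is where the sum over \<open>s\<close> comes
  from.\<close>

lemma prod_sum_Pow_incidence:
  fixes \<phi> :: "'v set \<Rightarrow> 'v set \<Rightarrow> real"
  assumes "hypergraph V F"
  shows "(\<Prod>\<alpha>\<in>F. \<Sum>I\<in>Pow \<alpha>. \<phi> \<alpha> I)
       = (\<Sum>s\<in>Pow (incidence_edges F). \<Prod>\<alpha>\<in>F. \<phi> \<alpha> (edge_vertices s \<alpha>))"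
proof -
  have "(\<Prod>\<alpha>\<in>F. \<Sum>I\<in>Pow \<alpha>. \<phi> \<alpha> I) = (\<Sum>g\<in>Pi\<^sub>E F Pow. \<Prod>\<alpha>\<in>F. \<phi> \<alpha> (g \<alpha>))"
    by (rule prod_sum_PiE) (use hypergraph_finite[OF assms] in auto)
  also have "\<dots> = (\<Sum>s\<in>Pow (incidence_edges F). \<Prod>\<alpha>\<in>F. \<phi> \<alpha> (edge_vertices s \<alpha>))"
  proof (rule sum.reindex_bij_witness[of _ "\<lambda>s. restrict (edge_vertices s) F"
        "\<lambda>g. {(i, \<alpha>). \<alpha> \<in> F \<and> i \<in> g \<alpha>}"], goal_cases)
    case (1 g)
    show ?case
    proof
      show "restrict (edge_vertices {(i, \<alpha>). \<alpha> \<in> F \<and> i \<in> g \<alpha>}) F \<alpha> = g \<alpha>" for \<alpha>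
        using PiE_arb[OF 1, of \<alpha>] by (cases "\<alpha> \<in> F") (simp_all add: edge_vertices_def)
    qed
  next
    case (2 g)
    then show ?case unfolding incidence_edges_def by (blast dest: PiE_mem)
  next
    case (3 s)
    then have "\<alpha> \<in> F" if "(i, \<alpha>) \<in> s" for i \<alpha>
      using that unfolding incidence_edges_def by blast
    then show ?case by (auto simp: edge_vertices_def)
  next
    case (4 s)
    then show ?case unfolding incidence_edges_def edge_vertices_def by (auto simp: PiE_iff)
  next
    case (5 g)
    then show ?case by (intro prod.cong) (simp_all add: edge_vertices_def)
  qed
  finally show ?thesis .
qed

lemma locally_consistent_vertex:
  assumes "locally_consistent V F b bv" "i \<in> V"
  shows "bv i 1 > 0" "bv i (-1) > 0" "bv i 1 + bv i (-1) = 1"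
  using assms unfolding locally_consistent_def positive_probability_on_def
  by (auto simp: add.commute)

text \<open>Group the configurations by the spin at \<open>i\<close>. Local consistency thereby
  passes from marginals to every function of one spin, which is what the averages in the free energy
  require.\<close>

lemma expectation_vertex_function:
  assumes "locally_consistent V F b bv" "\<alpha> \<in> F" "i \<in> \<alpha>" "finite \<alpha>"
  shows "(\<Sum>x\<in>configs \<alpha>. b \<alpha> x * \<phi> (x i)) = (\<Sum>t\<in>{-1, 1}. bv i t * \<phi> t)"
proof -
  have "(\<Sum>x\<in>configs \<alpha>. b \<alpha> x * \<phi> (x i))
      = (\<Sum>t\<in>{-1, 1}. \<Sum>x\<in>{x \<in> configs \<alpha>. x i = t}. b \<alpha> x * \<phi> (x i))"
    by (rule sum.group[symmetric, OF finite_configs])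
       (use assms configs_value[of _ \<alpha> i] in auto)
  also have "\<dots> = (\<Sum>t\<in>{-1, 1}. marginal \<alpha> (b \<alpha>) i t * \<phi> t)"
    by (simp add: marginal_def sum_distrib_right)
  also have "\<dots> = (\<Sum>t\<in>{-1, 1}. bv i t * \<phi> t)"
    using assms unfolding locally_consistent_def by (intro sum.cong) auto
  finally show ?thesis .
qed

section \<open>The Bethe approximation\<close>

text \<open>Each \<open>l \<alpha>'\<close> is counted once for every other element of
  \<open>A\<close>. The subtraction is in the reals, so the formula also covers empty
  \<open>A\<close>, that is, isolated vertices.\<close>

lemma sum_others_over_incident:
  fixes l :: "'a \<Rightarrow> real"
  assumes "finite A"
  shows "(\<Sum>\<alpha>\<in>A. \<Sum>\<alpha>'\<in>A - {\<alpha>}. l \<alpha>') = (real (card A) - 1) * sum l A"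
proof -
  have "(\<Sum>\<alpha>\<in>A. \<Sum>\<alpha>'\<in>A - {\<alpha>}. l \<alpha>') = (\<Sum>\<alpha>\<in>A. sum l A - l \<alpha>)"
    using assms by (intro sum.cong refl) (simp add: sum_diff1)
  then show ?thesis by (simp add: sum_subtractf algebra_simps)
qed

text \<open>Identifies the constant of the reparametrisation. In logarithms, a message into
  \<open>j\<close> is counted \<open>d j - 1\<close> times by the hyperedge beliefs and
  \<open>1 - d j\<close> times by the vertex belief. The messages therefore cancel, pointwise as
  well as on average, and the same combination of normalising constants remains in both
  cases.\<close>

lemma exp_bethe_free_energy:
  assumes H: "hypergraph V F"
    and \<Psi>: "\<forall>\<alpha>\<in>F. \<forall>x\<in>configs \<alpha>. \<Psi> \<alpha> x > 0"
    and lc: "locally_consistent V F b bv"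
    and bm: "beliefs_of_messages V F \<Psi> \<mu> b bv"
    and x: "x \<in> configs V"
  shows "weight F b x * (\<Prod>i\<in>V. bv i (x i) powi (1 - int (vertex_degree F i)))
       = exp (bethe_free_energy V F \<Psi> b bv) * weight F \<Psi> x"
proof -
  note fin = hypergraph_finite[OF H]
  define N where "N j = {\<alpha> \<in> F. j \<in> \<alpha>}" for j
  \<comment> \<open>\<open>L j t\<close> is the total log-message into \<open>j\<close>;
    \<open>e \<alpha> j t\<close> is the same with the message from \<alpha> left out (the cavity
    field).\<close>
  define L where "L j t = (\<Sum>\<alpha>\<in>N j. ln (\<mu> \<alpha> j t))" for j t
  define e where "e \<alpha> j t = (\<Sum>\<alpha>'\<in>N j - {\<alpha>}. ln (\<mu> \<alpha>' j t))" for \<alpha> j t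
  define d where "d j = real (vertex_degree F j)" for j
  have finN: "finite (N j)" for j using fin by (simp add: N_def)
  have \<mu>: "\<mu> \<alpha> j t > 0" if "\<alpha> \<in> N j" "t \<in> {-1, 1}" for \<alpha> j t
    using bm that unfolding beliefs_of_messages_def N_def by blast
  have bpos: "b \<alpha> y > 0" if "\<alpha> \<in> F" "y \<in> configs \<alpha>" for \<alpha> y
    using lc that unfolding locally_consistent_def positive_probability_on_def by blast
  have bsum: "sum (b \<alpha>) (configs \<alpha>) = 1" if "\<alpha> \<in> F" for \<alpha>
    using lc that unfolding locally_consistent_def positive_probability_on_def by blast
  have bvpos: "bv i t > 0" if "i \<in> V" "t \<in> {-1, 1}" for i t
    using locally_consistent_vertex[OF lc that(1)] that(2) by auto
  have bvsum: "(\<Sum>t\<in>{-1, 1}. bv i t) = 1" if "i \<in> V" for i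
    using locally_consistent_vertex[OF lc that] by simp
  have e_sum: "(\<Sum>\<alpha>\<in>N j. e \<alpha> j t) = (d j - 1) * L j t" for j t
    using sum_others_over_incident[OF finN[of j], where l = "\<lambda>\<alpha>. ln (\<mu> \<alpha> j t)"]
    by (simp add: e_def L_def d_def vertex_degree_def N_def)

  \<comment> \<open>Logarithms of the message formulas: the normalising factors become the additive
    constants \<open>kv i\<close> for vertices and, below, \<open>k \<alpha>\<close> for
    hyperedges.\<close>
  have "\<exists>k. \<forall>t\<in>{-1, 1}. ln (bv i t) = k + L i t" if i: "i \<in> V" for i
  proof -
    obtain c where c: "c > 0" "\<forall>t\<in>{-1, 1}. bv i t = c * (\<Prod>\<alpha>\<in>N i. \<mu> \<alpha> i t)"
      using bm i unfolding beliefs_of_messages_def proportional_on_def N_def by meson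
    have "ln (bv i t) = ln c + L i t" if t: "t \<in> {-1, 1}" for t
    proof -
      have "ln (\<Prod>\<alpha>\<in>N i. \<mu> \<alpha> i t) = L i t"
        unfolding L_def by (rule ln_prod[OF finN]) (use \<mu>[OF _ t] in fastforce)
      moreover have "(\<Prod>\<alpha>\<in>N i. \<mu> \<alpha> i t) > 0" by (rule prod_pos) (use \<mu> t in blast)
      moreover have "bv i t = c * (\<Prod>\<alpha>\<in>N i. \<mu> \<alpha> i t)" using c(2) t by blast
      ultimately show ?thesis using c(1) by (simp add: ln_mult)
    qed
    then show ?thesis by blast
  qed
  then obtain kv where kv: "\<And>i t. i \<in> V \<Longrightarrow> t \<in> {-1, 1} \<Longrightarrow> ln (bv i t) = kv i + L i t"
    by metis

  have "\<exists>k. \<forall>y\<in>configs \<alpha>. ln (b \<alpha> y) = ln (\<Psi> \<alpha> y) + (k + (\<Sum>j\<in>\<alpha>. e \<alpha> j (y j)))"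
    if a: "\<alpha> \<in> F" for \<alpha>
  proof -
    have N': "{\<alpha>' \<in> F. j \<in> \<alpha>' \<and> \<alpha>' \<noteq> \<alpha>} = N j - {\<alpha>}" for \<alpha> j
      by (auto simp: N_def)
    obtain c where c: "c > 0"
      "\<forall>y\<in>configs \<alpha>. b \<alpha> y = c * (\<Psi> \<alpha> y * (\<Prod>j\<in>\<alpha>. \<Prod>\<alpha>'\<in>N j - {\<alpha>}. \<mu> \<alpha>' j (y j)))"
      using bm a unfolding beliefs_of_messages_def proportional_on_def N' by meson
    have "ln (b \<alpha> y) = ln (\<Psi> \<alpha> y) + (ln c + (\<Sum>j\<in>\<alpha>. e \<alpha> j (y j)))"
      if y: "y \<in> configs \<alpha>" for y
    proof -
      have pos: "(\<Prod>\<alpha>'\<in>N j - {\<alpha>}. \<mu> \<alpha>' j (y j)) > 0" if "j \<in> \<alpha>" for j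
        by (rule prod_pos) (use \<mu> configs_value[OF y that] in blast)
      have "ln (\<Prod>j\<in>\<alpha>. \<Prod>\<alpha>'\<in>N j - {\<alpha>}. \<mu> \<alpha>' j (y j))
          = (\<Sum>j\<in>\<alpha>. ln (\<Prod>\<alpha>'\<in>N j - {\<alpha>}. \<mu> \<alpha>' j (y j)))"
        by (rule ln_prod) (use pos fin(4)[OF a] in fastforce)+
      also have "\<dots> = (\<Sum>j\<in>\<alpha>. e \<alpha> j (y j))"
      proof (rule sum.cong[OF refl])
        fix j assume j: "j \<in> \<alpha>"
        show "ln (\<Prod>\<alpha>'\<in>N j - {\<alpha>}. \<mu> \<alpha>' j (y j)) = e \<alpha> j (y j)"
          unfolding e_def
          by (rule ln_prod) (use finN \<mu>[OF _ configs_value[OF y j]] in fastforce)+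
      qed
      finally have "ln (\<Prod>j\<in>\<alpha>. \<Prod>\<alpha>'\<in>N j - {\<alpha>}. \<mu> \<alpha>' j (y j)) = (\<Sum>j\<in>\<alpha>. e \<alpha> j (y j))" .
      moreover have "(\<Prod>j\<in>\<alpha>. \<Prod>\<alpha>'\<in>N j - {\<alpha>}. \<mu> \<alpha>' j (y j)) > 0"
        by (rule prod_pos) (use pos in auto)
      moreover have "\<Psi> \<alpha> y > 0" using \<Psi> a y by blast
      ultimately show ?thesis using c y by (simp add: ln_mult)
    qed
    then show ?thesis by blast
  qed
  then obtain k where k: "\<And>\<alpha> y. \<alpha> \<in> F \<Longrightarrow> y \<in> configs \<alpha> \<Longrightarrow>
      ln (b \<alpha> y) = ln (\<Psi> \<alpha> y) + (k \<alpha> + (\<Sum>j\<in>\<alpha>. e \<alpha> j (y j)))"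
    by metis

  \<comment> \<open>What is left once the messages cancel: first the free energy and then the
    logarithm of the ratio of weights at \<open>x\<close> are shown to equal
    \<open>K\<close>.\<close>
  define K where "K = (\<Sum>\<alpha>\<in>F. k \<alpha>) + (\<Sum>i\<in>V. (1 - d i) * kv i)"

  have "bethe_free_energy V F \<Psi> b bv
      = (\<Sum>\<alpha>\<in>F. \<Sum>y\<in>configs \<alpha>. b \<alpha> y * (ln (b \<alpha> y) - ln (\<Psi> \<alpha> y)))
        + (\<Sum>i\<in>V. (1 - d i) * (\<Sum>t\<in>{-1, 1}. bv i t * ln (bv i t)))"
    by (simp add: bethe_free_energy_def d_def sum_subtractf right_diff_distrib)
  \<comment> \<open>By \<open>k\<close>, the averaged function is a constant plus functions of
    single spins, so its mean involves only the vertex beliefs.\<close>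
  also have "(\<Sum>\<alpha>\<in>F. \<Sum>y\<in>configs \<alpha>. b \<alpha> y * (ln (b \<alpha> y) - ln (\<Psi> \<alpha> y)))
      = (\<Sum>\<alpha>\<in>F. k \<alpha> + (\<Sum>j\<in>\<alpha>. \<Sum>t\<in>{-1, 1}. bv j t * e \<alpha> j t))"
  proof (rule sum.cong[OF refl])
    fix \<alpha> assume a: "\<alpha> \<in> F"
    have "(\<Sum>y\<in>configs \<alpha>. b \<alpha> y * (ln (b \<alpha> y) - ln (\<Psi> \<alpha> y)))
        = (\<Sum>y\<in>configs \<alpha>. k \<alpha> * b \<alpha> y + (\<Sum>j\<in>\<alpha>. b \<alpha> y * e \<alpha> j (y j)))"
      by (rule sum.cong) (auto simp: k[OF a] algebra_simps sum_distrib_left)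
    also have "\<dots> = k \<alpha> + (\<Sum>j\<in>\<alpha>. \<Sum>y\<in>configs \<alpha>. b \<alpha> y * e \<alpha> j (y j))"
      unfolding sum.distrib sum.swap[of _ \<alpha>] sum_distrib_left[symmetric, of "k \<alpha>"] bsum[OF a]
      by simp
    also have "(\<Sum>j\<in>\<alpha>. \<Sum>y\<in>configs \<alpha>. b \<alpha> y * e \<alpha> j (y j))
        = (\<Sum>j\<in>\<alpha>. \<Sum>t\<in>{-1, 1}. bv j t * e \<alpha> j t)"
      by (rule sum.cong[OF refl])
         (use expectation_vertex_function[OF lc a] fin(4)[OF a] in blast)
    finally show "(\<Sum>y\<in>configs \<alpha>. b \<alpha> y * (ln (b \<alpha> y) - ln (\<Psi> \<alpha> y)))
      = k \<alpha> + (\<Sum>j\<in>\<alpha>. \<Sum>t\<in>{-1, 1}. bv j t * e \<alpha> j t)" .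
  qed
  also have "\<dots> = (\<Sum>\<alpha>\<in>F. k \<alpha>) + (\<Sum>j\<in>V. \<Sum>\<alpha>\<in>N j. \<Sum>t\<in>{-1, 1}. bv j t * e \<alpha> j t)"
    unfolding N_def sum.distrib sum_incidence_swap[OF H] ..
  also have "(\<Sum>j\<in>V. \<Sum>\<alpha>\<in>N j. \<Sum>t\<in>{-1, 1}. bv j t * e \<alpha> j t)
      = (\<Sum>j\<in>V. \<Sum>t\<in>{-1, 1}. bv j t * ((d j - 1) * L j t))"
    unfolding e_sum[symmetric] sum_distrib_left by (intro sum.cong refl sum.swap)
  \<comment> \<open>The vertex entropies yield the same message averages with the opposite
    sign.\<close>
  also have "(\<Sum>i\<in>V. (1 - d i) * (\<Sum>t\<in>{-1, 1}. bv i t * ln (bv i t)))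
      = (\<Sum>i\<in>V. (1 - d i) * kv i - (\<Sum>t\<in>{-1, 1}. bv i t * ((d i - 1) * L i t)))"
  proof (rule sum.cong[OF refl])
    fix i assume i: "i \<in> V"
    have "(1 - d i) * (\<Sum>t\<in>{-1, 1}. bv i t * ln (bv i t))
        = (\<Sum>t\<in>{-1, 1}. (1 - d i) * kv i * bv i t - bv i t * ((d i - 1) * L i t))"
      unfolding sum_distrib_left by (rule sum.cong) (simp_all add: kv[OF i] algebra_simps)
    also have "\<dots> = (1 - d i) * kv i - (\<Sum>t\<in>{-1, 1}. bv i t * ((d i - 1) * L i t))"
      unfolding sum_subtractf sum_distrib_left[symmetric] bvsum[OF i] by simp
    finally show "(1 - d i) * (\<Sum>t\<in>{-1, 1}. bv i t * ln (bv i t)) = \<dots>" .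
  qed
  finally have free_energy: "bethe_free_energy V F \<Psi> b bv = K"
    by (simp add: K_def sum_subtractf)

  \<comment> \<open>The same cancellation, now at the fixed configuration \<open>x\<close> instead
    of on average.\<close>
  have xV: "x i \<in> {-1, 1}" if "i \<in> V" for i using configs_value[OF x that] .
  have r: "restrict x \<alpha> \<in> configs \<alpha>" if "\<alpha> \<in> F" for \<alpha>
    using restrict_configs[OF x] fin(3) that by blast
  have "weight F b x = (\<Prod>\<alpha>\<in>F. exp (ln (b \<alpha> (restrict x \<alpha>))))"
    unfolding weight_def by (intro prod.cong refl) (simp add: bpos r)
  also have "\<dots> = (\<Prod>\<alpha>\<in>F. \<Psi> \<alpha> (restrict x \<alpha>) * exp (k \<alpha> + (\<Sum>j\<in>\<alpha>. e \<alpha> j (x j))))"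
    using \<Psi> by (intro prod.cong refl) (simp add: k r exp_add)
  also have "\<dots> = weight F \<Psi> x * exp (\<Sum>\<alpha>\<in>F. k \<alpha> + (\<Sum>j\<in>\<alpha>. e \<alpha> j (x j)))"
    by (simp add: weight_def prod.distrib exp_sum fin)
  also have "(\<Sum>\<alpha>\<in>F. k \<alpha> + (\<Sum>j\<in>\<alpha>. e \<alpha> j (x j)))
      = (\<Sum>\<alpha>\<in>F. k \<alpha>) + (\<Sum>j\<in>V. \<Sum>\<alpha>\<in>N j. e \<alpha> j (x j))"
    unfolding N_def sum.distrib sum_incidence_swap[OF H] ..
  finally have wb: "weight F b x
      = weight F \<Psi> x * exp ((\<Sum>\<alpha>\<in>F. k \<alpha>) + (\<Sum>j\<in>V. (d j - 1) * L j (x j)))"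
    unfolding e_sum .
  have "(\<Prod>i\<in>V. bv i (x i) powi (1 - int (vertex_degree F i)))
      = (\<Prod>i\<in>V. exp ((1 - d i) * (kv i + L i (x i))))"
  proof (rule prod.cong[OF refl])
    fix i assume i: "i \<in> V"
    have "bv i (x i) powi (1 - int (vertex_degree F i))
        = bv i (x i) powr real_of_int (1 - int (vertex_degree F i))"
      by (rule powr_real_of_int'[symmetric]) (use bvpos[OF i xV[OF i]] in auto)
    also have "\<dots> = exp ((1 - d i) * ln (bv i (x i)))"
      using bvpos[OF i xV[OF i]] by (simp add: powr_def d_def)
    finally show "bv i (x i) powi (1 - int (vertex_degree F i))
        = exp ((1 - d i) * (kv i + L i (x i)))"
      by (simp add: kv[OF i xV[OF i]])
  qed
  also have "\<dots> = exp (\<Sum>i\<in>V. (1 - d i) * (kv i + L i (x i)))"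
    by (simp add: exp_sum fin)
  finally have "weight F b x * (\<Prod>i\<in>V. bv i (x i) powi (1 - int (vertex_degree F i)))
      = weight F \<Psi> x * exp ((\<Sum>\<alpha>\<in>F. k \<alpha>) + (\<Sum>j\<in>V. (d j - 1) * L j (x j))
          + (\<Sum>i\<in>V. (1 - d i) * (kv i + L i (x i))))"
    by (simp add: wb exp_add)
  also have "(\<Sum>\<alpha>\<in>F. k \<alpha>) + (\<Sum>j\<in>V. (d j - 1) * L j (x j))
          + (\<Sum>i\<in>V. (1 - d i) * (kv i + L i (x i))) = K"
    by (simp add: K_def sum.distrib[symmetric] algebra_simps)
  finally show ?thesis by (simp add: free_energy)
qed

section \<open>Moments of the standardised spins\<close>

text \<open>With \<open>p = bv i 1\<close> and \<open>q = bv i (-1)\<close>, the mean is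
  \<open>m = p - q\<close>. Since \<open>p + q = 1\<close>, it follows that
  \<open>1 - m = 2 * q\<close>, \<open>1 + m = 2 * p\<close>, and hence
  \<open>1 - m^2 = 4 * p * q\<close>.\<close>

lemma two_point_law:
  assumes "bv i 1 > 0" "bv i (-1) > 0" "bv i 1 + bv i (-1) = (1::real)"
  defines "\<sigma> \<equiv> sqrt (1 - (belief_mean bv i)\<^sup>2)"
  shows "belief_mean bv i = bv i 1 - bv i (-1)"
    and "sqrt (bv i 1 * bv i (-1)) = \<sigma> / 2"
    and "\<sigma> > 0" and "\<sigma>\<^sup>2 = 4 * bv i 1 * bv i (-1)"
    and "standardised bv i 1 = 2 * bv i (-1) / \<sigma>"
    and "standardised bv i (-1) = - 2 * bv i 1 / \<sigma>"
proof -
  have q: "bv i (-1) = 1 - bv i 1" using assms(3) by simp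
  show m: "belief_mean bv i = bv i 1 - bv i (-1)" by (simp add: belief_mean_def)
  have eq: "1 - (belief_mean bv i)\<^sup>2 = 4 * (bv i 1 * bv i (-1))"
    unfolding m q by (simp add: power2_eq_square algebra_simps)
  have pos: "bv i 1 * bv i (-1) > 0" using assms by simp
  show "sqrt (bv i 1 * bv i (-1)) = \<sigma> / 2" unfolding \<sigma>_def eq by (simp add: real_sqrt_mult)
  show "\<sigma> > 0" unfolding \<sigma>_def eq using pos by simp
  show "\<sigma>\<^sup>2 = 4 * bv i 1 * bv i (-1)" unfolding \<sigma>_def eq using pos by simp
  show "standardised bv i 1 = 2 * bv i (-1) / \<sigma>"
    unfolding standardised_def \<sigma>_def m q by simp
  show "standardised bv i (-1) = - 2 * bv i 1 / \<sigma>"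
    unfolding standardised_def \<sigma>_def m q by (simp add: divide_simps)
qed

text \<open>Completeness of the orthonormal basis: summing the products of basis functions at
  \<open>s\<close> and \<open>t\<close> gives the reproducing kernel of a two-point space, the delta
  function divided by the weight.\<close>

lemma standardised_kernel:
  assumes "bv i 1 > 0" "bv i (-1) > 0" "bv i 1 + bv i (-1) = (1::real)"
    and "s \<in> {-1, 1}" "t \<in> {-1, 1}"
  shows "bv i t * (1 + standardised bv i s * standardised bv i t) = (if s = t then 1 else 0)"
proof -
  define \<sigma> where "\<sigma> = sqrt (1 - (belief_mean bv i)\<^sup>2)"
  note l = two_point_law[of bv i, OF assms(1-3), folded \<sigma>_def]
  have a: "standardised bv i 1 * standardised bv i (-1) = -1"
    unfolding l(5,6) using l(3,4) assms(1,2) by (simp add: field_simps power2_eq_square)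
  have b: "bv i 1 * (standardised bv i 1)\<^sup>2 = bv i (-1)"
    unfolding l(5) power_divide l(4) using assms by (simp add: field_simps power2_eq_square)
  have c: "bv i (-1) * (standardised bv i (-1))\<^sup>2 = bv i 1"
    unfolding l(6) power_divide l(4) using assms by (simp add: field_simps power2_eq_square)
  have "bv i t * (1 + standardised bv i s * standardised bv i t)
      = bv i t + bv i t * (standardised bv i s * standardised bv i t)"
    by (simp add: distrib_left)
  then show ?thesis
    using assms(3-5) a b c by (auto simp: power2_eq_square mult.commute)
qed

text \<open>Vieta: the two standardised values have product -1 and sum
  \<open>- loop_gamma bv i\<close>. Passing to their negatives makes the coefficient
  \<open>+ loop_gamma bv i\<close>, as in the recursions of \<open>loop_f\<close> and
  \<open>loop_g\<close>.\<close>

lemma standardised_root: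
  assumes "bv i 1 > 0" "bv i (-1) > 0" "bv i 1 + bv i (-1) = (1::real)" "t \<in> {-1, 1}"
  shows "(- standardised bv i t)\<^sup>2 = loop_gamma bv i * (- standardised bv i t) + 1"
proof -
  define \<sigma> where "\<sigma> = sqrt (1 - (belief_mean bv i)\<^sup>2)"
  note l = two_point_law[of bv i, OF assms(1-3), folded \<sigma>_def]
  have a: "standardised bv i 1 * standardised bv i (-1) = -1"
    unfolding l(5,6) using l(3,4) assms(1,2) by (simp add: field_simps power2_eq_square)
  have "standardised bv i 1 + standardised bv i (-1) = - loop_gamma bv i"
    unfolding l(5,6) loop_gamma_def \<sigma>_def[symmetric] unfolding l(1) by (simp add: diff_divide_distrib)
  then have g: "loop_gamma bv i = - (standardised bv i 1 + standardised bv i (-1))" by simp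
  show ?thesis
    using assms(4) a unfolding g by (auto simp: power2_eq_square algebra_simps)
qed

lemma root_power_recursion:
  fixes y :: real
  assumes "y\<^sup>2 = g * y + 1"
  shows "y ^ Suc (Suc n) = g * y ^ Suc n + y ^ n"
proof -
  have "y ^ Suc (Suc n) = y ^ n * y\<^sup>2" by (simp add: power2_eq_square)
  then show ?thesis unfolding assms by (simp add: algebra_simps)
qed

text \<open>The quadratic relation holds at each \<open>t\<close> separately, so the weight \<phi>
  is arbitrary. The two families of moments thus differ only in their initial values.\<close>

lemma moment_recursion:
  fixes \<phi> :: "real \<Rightarrow> real"
  assumes "bv i 1 > 0" "bv i (-1) > 0" "bv i 1 + bv i (-1) = (1::real)"
  defines "M \<equiv> \<lambda>n. \<Sum>t\<in>{-1, 1}. \<phi> t * (- standardised bv i t) ^ n"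
  shows "M (Suc (Suc n)) = loop_gamma bv i * M (Suc n) + M n"
proof -
  have "M (Suc (Suc n)) = (\<Sum>t\<in>{-1, 1}. \<phi> t *
      (loop_gamma bv i * (- standardised bv i t) ^ Suc n + (- standardised bv i t) ^ n))"
    unfolding M_def
  proof (rule sum.cong[OF refl])
    fix t :: real assume "t \<in> {-1, 1}"
    from root_power_recursion[OF standardised_root[of bv i, OF assms(1-3) this]]
    show "\<phi> t * (- standardised bv i t) ^ Suc (Suc n) = \<phi> t *
      (loop_gamma bv i * (- standardised bv i t) ^ Suc n + (- standardised bv i t) ^ n)"
      by (rule arg_cong)
  qed
  also have "\<dots> = loop_gamma bv i * M (Suc n) + M n"
    unfolding M_def sum_distrib_left sum.distrib[symmetric]
    by (rule sum.cong[OF refl]) (simp add: algebra_simps del: power_Suc)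
  finally show ?thesis .
qed

text \<open>The initial values 1 and 0 are the total mass and the mean of the negated standardised
  spin.\<close>

lemma loop_f_moment:
  assumes "bv i 1 > 0" "bv i (-1) > 0" "bv i 1 + bv i (-1) = (1::real)"
  shows "(\<Sum>t\<in>{-1, 1}. bv i t * (- standardised bv i t) ^ n) = poly (loop_f n) (loop_gamma bv i)"
proof (induction n rule: loop_f.induct)
  case 1
  show ?case using assms by simp
next
  case 2
  show ?case using two_point_law(5,6)[of bv i, OF assms] by simp
next
  case (3 n)
  then show ?case using moment_recursion[of bv i "bv i" n, OF assms] by simp
qed

text \<open>Write \<open>x = m + \<sigma> * y\<close> with \<open>y\<close> standardised. The extra
  factor is \<open>2 * x / \<sigma>\<close>; its mean is \<open>loop_gamma bv i\<close>, and its
  mean against \<open>- y\<close> is -2 because \<open>y\<close> has mean 0 and variance 1.\<close>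

lemma loop_g_moment:
  assumes "bv i 1 > 0" "bv i (-1) > 0" "bv i 1 + bv i (-1) = (1::real)"
  shows "(\<Sum>t\<in>{-1, 1}. bv i t * (t / sqrt (bv i 1 * bv i (-1))) * (- standardised bv i t) ^ n)
       = poly (loop_g n) (loop_gamma bv i)"
proof (induction n rule: loop_g.induct)
  case 1
  show ?case
    using assms by (simp add: two_point_law(2)[of bv i, OF assms] loop_gamma_def belief_mean_def
      right_diff_distrib diff_divide_distrib mult_ac)
next
  case 2
  define \<sigma> where "\<sigma> = sqrt (1 - (belief_mean bv i)\<^sup>2)"
  note l = two_point_law[of bv i, OF assms, folded \<sigma>_def]
  show ?case
    using l(3,4) assms unfolding l(2) by (simp add: l(5,6) field_simps power2_eq_square)
next
  case (3 n)
  then show ?case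
    using moment_recursion[of bv i "\<lambda>t. bv i t * (t / sqrt (bv i 1 * bv i (-1)))" n, OF assms]
    by simp
qed

section \<open>Expansion over sets of incidences\<close>

text \<open>Insert the definition of \<open>loop_beta\<close> as a sum over \<open>z\<close>. The
  sum over \<open>I\<close> then factorises into \<open>1 + y (z i) * y (x i)\<close>, with
  \<open>y\<close> the standardised spin; together with the vertex beliefs these are the kernels
  above, which leave only \<open>z = x\<close>.\<close>

lemma belief_expansion:
  assumes H: "hypergraph V F" and lc: "locally_consistent V F b bv"
    and a: "\<alpha> \<in> F" and x: "x \<in> configs \<alpha>"
  shows "b \<alpha> x = (\<Prod>i\<in>\<alpha>. bv i (x i)) *
           (\<Sum>I\<in>Pow \<alpha>. loop_beta b bv \<alpha> I * (\<Prod>i\<in>I. standardised bv i (x i)))"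
proof -
  note fin = hypergraph_finite[OF H]
  let ?y = "standardised bv"
  have fa: "finite \<alpha>" and aV: "\<alpha> \<subseteq> V" using fin a by auto
  have "(\<Sum>I\<in>Pow \<alpha>. loop_beta b bv \<alpha> I * (\<Prod>i\<in>I. ?y i (x i)))
      = (\<Sum>z\<in>configs \<alpha>. b \<alpha> z * (\<Sum>I\<in>Pow \<alpha>. \<Prod>i\<in>I. ?y i (z i) * ?y i (x i)))"
    unfolding loop_beta_def standardised_def[symmetric] sum_distrib_right sum_distrib_left
      prod.distrib mult.assoc by (rule sum.swap)
  also have "\<dots> = (\<Sum>z\<in>configs \<alpha>. b \<alpha> z * (\<Prod>i\<in>\<alpha>. 1 + ?y i (z i) * ?y i (x i)))"
    using prod_add[OF fa, of "\<lambda>i. ?y i (_ i) * ?y i (x i)" "\<lambda>_. 1"]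
    by (simp add: add.commute)
  finally have "(\<Prod>i\<in>\<alpha>. bv i (x i)) *
           (\<Sum>I\<in>Pow \<alpha>. loop_beta b bv \<alpha> I * (\<Prod>i\<in>I. ?y i (x i)))
      = (\<Sum>z\<in>configs \<alpha>. b \<alpha> z * (\<Prod>i\<in>\<alpha>. bv i (x i) * (1 + ?y i (z i) * ?y i (x i))))"
    by (simp add: sum_distrib_left prod.distrib mult_ac)
  also have "\<dots> = (\<Sum>z\<in>configs \<alpha>. if z = x then b \<alpha> z else 0)"
  proof (rule sum.cong[OF refl])
    fix z assume z: "z \<in> configs \<alpha>"
    have "(\<Prod>i\<in>\<alpha>. bv i (x i) * (1 + ?y i (z i) * ?y i (x i)))
        = (\<Prod>i\<in>\<alpha>. if z i = x i then 1 else 0)"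
    proof (rule prod.cong[OF refl])
      fix i assume i: "i \<in> \<alpha>"
      then have "i \<in> V" using aV by blast
      from standardised_kernel[of bv i, OF locally_consistent_vertex[OF lc this]
          configs_value[OF z i] configs_value[OF x i]]
      show "bv i (x i) * (1 + ?y i (z i) * ?y i (x i)) = (if z i = x i then 1 else 0)" .
    qed
    also have "\<dots> = (if z = x then 1 else 0)"
    proof (cases "z = x")
      case False
      then obtain i where "i \<in> \<alpha>" "z i \<noteq> x i"
        using x z unfolding configs_def by (metis PiE_ext)
      then show ?thesis using False fa by (auto intro!: prod_zero)
    qed simp
    finally show "b \<alpha> z * (\<Prod>i\<in>\<alpha>. bv i (x i) * (1 + ?y i (z i) * ?y i (x i)))
        = (if z = x then b \<alpha> z else 0)" by simp
  qed
  also have "\<dots> = b \<alpha> x" using x finite_configs[OF fa] by (simp add: sum.delta)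
  finally show ?thesis by simp
qed

text \<open>The hyperedge expansions supply each vertex belief to the power of the vertex degree.
  Against the exponent one minus the degree this leaves a single factor per vertex, a product
  measure.\<close>

lemma reparametrised_weight_expansion:
  assumes H: "hypergraph V F" and lc: "locally_consistent V F b bv" and x: "x \<in> configs V"
  shows "weight F b x * (\<Prod>i\<in>V. bv i (x i) powi (1 - int (vertex_degree F i)))
    = (\<Sum>s\<in>Pow (incidence_edges F). (-1) ^ card s *
        (\<Prod>\<alpha>\<in>F. loop_beta b bv \<alpha> (edge_vertices s \<alpha>)) *
        (\<Prod>i\<in>V. bv i (x i) * (- standardised bv i (x i)) ^ sub_degree s i))"
proof -
  note fin = hypergraph_finite[OF H]
  let ?y = "\<lambda>i. standardised bv i (x i)"
  let ?B = "\<lambda>s. \<Prod>\<alpha>\<in>F. loop_beta b bv \<alpha> (edge_vertices s \<alpha>)"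
  have "weight F b x = (\<Prod>\<alpha>\<in>F. (\<Prod>i\<in>\<alpha>. bv i (x i)) *
      (\<Sum>I\<in>Pow \<alpha>. loop_beta b bv \<alpha> I * (\<Prod>i\<in>I. ?y i)))"
    unfolding weight_def
  proof (rule prod.cong[OF refl])
    fix \<alpha> assume a: "\<alpha> \<in> F"
    have "(\<Prod>i\<in>I. standardised bv i (restrict x \<alpha> i)) = (\<Prod>i\<in>I. ?y i)" if "I \<in> Pow \<alpha>" for I
      using that by (intro prod.cong) auto
    then show "b \<alpha> (restrict x \<alpha>) = (\<Prod>i\<in>\<alpha>. bv i (x i)) *
      (\<Sum>I\<in>Pow \<alpha>. loop_beta b bv \<alpha> I * (\<Prod>i\<in>I. ?y i))"
      using belief_expansion[OF H lc a restrict_configs[OF x fin(3)[OF a]]] by simp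
  qed
  also have "\<dots> = (\<Prod>i\<in>V. bv i (x i) ^ vertex_degree F i) *
      (\<Sum>s\<in>Pow (incidence_edges F). ?B s * (\<Prod>\<alpha>\<in>F. \<Prod>i\<in>edge_vertices s \<alpha>. ?y i))"
    by (simp add: prod.distrib prod_incidence_by_vertex[OF H] prod_sum_Pow_incidence[OF H])
  finally have "weight F b x * (\<Prod>i\<in>V. bv i (x i) powi (1 - int (vertex_degree F i)))
    = (\<Prod>i\<in>V. bv i (x i) ^ vertex_degree F i * bv i (x i) powi (1 - int (vertex_degree F i))) *
      (\<Sum>s\<in>Pow (incidence_edges F). ?B s * (\<Prod>\<alpha>\<in>F. \<Prod>i\<in>edge_vertices s \<alpha>. ?y i))"
    by (simp add: prod.distrib)
  also have "(\<Prod>i\<in>V. bv i (x i) ^ vertex_degree F i *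
        bv i (x i) powi (1 - int (vertex_degree F i))) = (\<Prod>i\<in>V. bv i (x i))"
  proof (rule prod.cong[OF refl])
    fix i assume i: "i \<in> V"
    have "bv i (x i) \<noteq> 0"
      using locally_consistent_vertex[OF lc i] configs_value[OF x i] by auto
    then show "bv i (x i) ^ vertex_degree F i * bv i (x i) powi (1 - int (vertex_degree F i))
        = bv i (x i)"
      by (simp add: power_int_diff)
  qed
  also have "(\<Prod>i\<in>V. bv i (x i)) *
      (\<Sum>s\<in>Pow (incidence_edges F). ?B s * (\<Prod>\<alpha>\<in>F. \<Prod>i\<in>edge_vertices s \<alpha>. ?y i))
    = (\<Sum>s\<in>Pow (incidence_edges F). (-1) ^ card s * ?B s *
        (\<Prod>i\<in>V. bv i (x i) * (- ?y i) ^ sub_degree s i))"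
    unfolding sum_distrib_left
  proof (rule sum.cong[OF refl])
    fix s assume "s \<in> Pow (incidence_edges F)"
    then have s: "s \<subseteq> incidence_edges F" by simp
    \<comment> \<open>Negating every standardised spin costs one sign per incidence,
      \<open>(-1) ^ card s\<close> in total; this is the sign in the final formula.\<close>
    have "(\<Prod>i\<in>V. (- ?y i) ^ sub_degree s i)
        = (\<Prod>i\<in>V. (- 1) ^ sub_degree s i) * (\<Prod>i\<in>V. ?y i ^ sub_degree s i)"
      unfolding prod.distrib[symmetric] by (intro prod.cong refl power_minus)
    also have "\<dots> = (-1) ^ card s * (\<Prod>\<alpha>\<in>F. \<Prod>i\<in>edge_vertices s \<alpha>. ?y i)"
      using prod_edges_by_vertex[OF H s, of "\<lambda>_. -1"] prod_edge_vertices_by_vertex[OF H s, of ?y]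
      by simp
    finally show "(\<Prod>i\<in>V. bv i (x i)) * (?B s * (\<Prod>\<alpha>\<in>F. \<Prod>i\<in>edge_vertices s \<alpha>. ?y i))
      = (-1) ^ card s * ?B s * (\<Prod>i\<in>V. bv i (x i) * (- ?y i) ^ sub_degree s i)"
      by (simp add: prod.distrib mult_ac)
  qed
  finally show ?thesis .
qed

section \<open>The magnetisation and the summation over spins\<close>

text \<open>For a spin with values -1 and 1, the difference of the two marginals is its
  mean.\<close>

lemma magnetisation_numerator:
  assumes "finite V" "v \<in> V" "Z \<noteq> 0"
  shows "Z * (marginal V (\<lambda>x. w x / Z) v 1 - marginal V (\<lambda>x. w x / Z) v (-1))
       = (\<Sum>x\<in>configs V. w x * x v)"
proof -
  have "(\<Sum>x\<in>configs V. w x * x v)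
      = (\<Sum>t\<in>{-1, 1}. \<Sum>x\<in>{x \<in> configs V. x v = t}. w x * x v)"
    by (rule sum.group[symmetric, OF finite_configs])
       (use assms configs_value[of _ V v] in auto)
  also have "\<dots> = sum w {x \<in> configs V. x v = 1} - sum w {x \<in> configs V. x v = -1}"
    by (simp add: sum_negf)
  finally show ?thesis
    using assms(3) by (simp add: marginal_def flip: sum_divide_distrib diff_divide_distrib)
qed

theorem theorem6p4:
  fixes V :: "'v set" and F :: "'v set set"
    and \<Psi> b :: "'v set \<Rightarrow> ('v \<Rightarrow> real) \<Rightarrow> real"
    and bv :: "'v \<Rightarrow> real \<Rightarrow> real" and v :: 'v
  assumes "hypergraph V F"
    and "\<forall>\<alpha>\<in>F. \<forall>x\<in>configs \<alpha>. \<Psi> \<alpha> x > 0"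
    and "v \<in> V"
    and "lbp_fixed_point V F \<Psi> b bv"
  shows "partition_function V F \<Psi> / bethe_partition_function V F \<Psi> b bv *
           ((marginal V (gibbs V F \<Psi>) v 1 - marginal V (gibbs V F \<Psi>) v (-1)) /
              sqrt (bv v 1 * bv v (-1))) =
         (\<Sum>s\<in>Pow (incidence_edges F).
            (-1) ^ card s *
            (\<Prod>\<alpha>\<in>F. loop_beta b bv \<alpha> (edge_vertices s \<alpha>)) *
            (\<Prod>i\<in>V - {v}. poly (loop_f (sub_degree s i)) (loop_gamma bv i)) *
            poly (loop_g (sub_degree s v)) (loop_gamma bv v))"
proof -
  note H = assms(1)
  note fin = hypergraph_finite[OF H]
  have lc: "locally_consistent V F b bv"
    and "\<exists>\<mu>. beliefs_of_messages V F \<Psi> \<mu> b bv"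
    using assms(4) by (auto simp: lbp_fixed_point_def)
  then obtain \<mu> where bm: "beliefs_of_messages V F \<Psi> \<mu> b bv" by blast
  define Z where "Z = partition_function V F \<Psi>"
  define E where "E = exp (bethe_free_energy V F \<Psi> b bv)"
  define r where "r = sqrt (bv v 1 * bv v (-1))"
  \<comment> \<open>Carries the factor \<open>x v / r\<close> at \<open>v\<close> and 1 elsewhere,
    so that the inserted spin fits into a product over all vertices.\<close>
  define \<phi> where "\<phi> i t = (if i = v then t / r else 1)" for i and t :: real
  define C where "C s = (-1) ^ card s * (\<Prod>\<alpha>\<in>F. loop_beta b bv \<alpha> (edge_vertices s \<alpha>))" for s
  have "Z > 0"
    unfolding Z_def partition_function_def
  proof (rule sum_pos)
    show "configs V \<noteq> {}" by (auto simp: configs_def PiE_eq_empty_iff)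
    show "weight F \<Psi> x > 0" if "x \<in> configs V" for x
      unfolding weight_def
      by (rule prod_pos) (use assms(2) restrict_configs[OF that] fin(3) in blast)
  qed (simp add: finite_configs fin)
  then have num: "Z * (marginal V (gibbs V F \<Psi>) v 1 - marginal V (gibbs V F \<Psi>) v (-1))
      = (\<Sum>x\<in>configs V. weight F \<Psi> x * x v)"
    using magnetisation_numerator[OF fin(1) assms(3), of Z "weight F \<Psi>"]
    unfolding gibbs_def[abs_def] Z_def by simp
  \<comment> \<open>The marked vertex contributes a moment of the second family, every other vertex
    one of the first.\<close>
  have factor: "(\<Sum>t\<in>{-1, 1}. \<phi> i t * (bv i t * (- standardised bv i t) ^ n))
      = (if i = v then poly (loop_g n) (loop_gamma bv i) else poly (loop_f n) (loop_gamma bv i))"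
    if "i \<in> V" for i n
    using loop_f_moment[of bv i n, OF locally_consistent_vertex[OF lc that]]
      loop_g_moment[of bv i n, OF locally_consistent_vertex[OF lc that]]
    by (cases "i = v") (simp_all add: \<phi>_def r_def mult_ac)
  have "Z / bethe_partition_function V F \<Psi> b bv *
           ((marginal V (gibbs V F \<Psi>) v 1 - marginal V (gibbs V F \<Psi>) v (-1)) / r)
      = (\<Sum>x\<in>configs V. weight F \<Psi> x * x v) * E / r"
    unfolding num[symmetric] by (simp add: bethe_partition_function_def E_def exp_minus divide_inverse mult_ac)
  also have "\<dots> = (\<Sum>x\<in>configs V. (\<Prod>i\<in>V. \<phi> i (x i)) * (E * weight F \<Psi> x))"
    unfolding \<phi>_def using fin(1) assms(3)
    by (simp add: prod.delta sum_distrib_left sum_distrib_right sum_divide_distrib mult_ac)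
  also have "\<dots> = (\<Sum>x\<in>configs V. (\<Prod>i\<in>V. \<phi> i (x i)) * (\<Sum>s\<in>Pow (incidence_edges F). C s *
        (\<Prod>i\<in>V. bv i (x i) * (- standardised bv i (x i)) ^ sub_degree s i)))"
    unfolding E_def C_def
    by (intro sum.cong refl arg_cong2[where f = "(*)"])
       (simp only: exp_bethe_free_energy[OF H assms(2) lc bm, symmetric]
         reparametrised_weight_expansion[OF H lc])
  also have "\<dots> = (\<Sum>s\<in>Pow (incidence_edges F). C s * (\<Sum>x\<in>configs V.
        \<Prod>i\<in>V. \<phi> i (x i) * (bv i (x i) * (- standardised bv i (x i)) ^ sub_degree s i)))"
    unfolding sum_distrib_left prod.distrib[of "\<lambda>i. \<phi> i (_ i)"]
    by (subst sum.swap) (simp add: mult_ac)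
  \<comment> \<open>For fixed \<open>s\<close> the summand is a product of functions of single
    spins, so the sum over configurations is a product of two-term sums.\<close>
  also have "\<dots> = (\<Sum>s\<in>Pow (incidence_edges F). C s *
      (\<Prod>i\<in>V. \<Sum>t\<in>{-1, 1}. \<phi> i t * (bv i t * (- standardised bv i t) ^ sub_degree s i)))"
    unfolding configs_def using fin(1) by (subst prod_sum_PiE) auto
  also have "\<dots> = (\<Sum>s\<in>Pow (incidence_edges F). C s *
      ((\<Prod>i\<in>V - {v}. poly (loop_f (sub_degree s i)) (loop_gamma bv i)) *
        poly (loop_g (sub_degree s v)) (loop_gamma bv v)))"
  proof (intro sum.cong refl arg_cong2[where f = "(*)"])
    fix s
    have "(\<Prod>i\<in>V. \<Sum>t\<in>{-1, 1}. \<phi> i t * (bv i t * (- standardised bv i t) ^ sub_degree s i))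
      = (\<Prod>i\<in>V. if i = v then poly (loop_g (sub_degree s i)) (loop_gamma bv i)
                  else poly (loop_f (sub_degree s i)) (loop_gamma bv i))"
      by (intro prod.cong refl factor)
    also have "\<dots> = (\<Prod>i\<in>V - {v}. poly (loop_f (sub_degree s i)) (loop_gamma bv i)) *
        poly (loop_g (sub_degree s v)) (loop_gamma bv v)"
      using fin(1) assms(3) by (simp add: prod.remove[of V v] mult.commute)
    finally show "(\<Prod>i\<in>V. \<Sum>t\<in>{-1, 1}. \<phi> i t * (bv i t * (- standardised bv i t) ^ sub_degree s i))
      = \<dots>" .
  qed
  finally show ?thesis
    unfolding Z_def r_def C_def by (simp only: mult.assoc)
qed

end
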